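(* Let $\omega\in\mathcal W_{\mathrm{Dou}}$ be a Douglas weight. Then the harmonic Dirichlet space $\mathcal D^h(\omega)$ is a Dirichlet space in the sense of Beurling–Deny.
   Context: $\mathbb D$ is the open unit disk, $\mathbb T$ the unit circle, $dA$ the normalized area measure on $\mathbb D$, $m$ the normalized Lebesgue measure on $\mathbb T$, $L^2(\mathbb T)=L^2(\mathbb T,m)$. A weight is a measurable function $\omega:\mathbb D\to[0,\infty)$ with $\int_{\mathbb D}\omega\,dA<\infty$. For $f\in L^2(\mathbb T)$, $P[f]$ is its Poisson extension to $\mathbb D$. The gradient is normalized by $\nabla u=(\partial u,\bar\partial u)$, so $|\nabla u|^2=|\partial u|^2+|\bar\partial u|^2$. Put $\mathcal E_\omega(f,g)=\int_{\mathbb D}\nabla P[f]\cdot\overline{\nabla P[g]}\,\omega\,dA$ and $\mathcal D^h(\omega)=\{f\in L^2(\mathbb T):\mathcal E_\omega(f,f)<\infty\}$, a Hilbert space with inner product $\langle f,g\rangle_{\mathcal D^h(\omega)}=\langle f,g\rangle_{L^2(\mathbb T)}+\mathcal E_\omega(f,g)$. A weight $\omega$ belongs to $\mathcal W_{\mathrm{Dou}}$ if there is a positive Borel measure $\mathbf J_\omega$ on $\mathbb T^2\setminus\mathrm{diag}$ with $\int_{\mathbb D}|\nabla P[f]|^2\omega\,dA=\int_{\mathbb T}\int_{\mathbb T}|f(\zeta)-f(\lambda)|^2\,\mathbf J_\omega(d\zeta,d\lambda)$ for every $f\in L^2(\mathbb T)$. A normalized contraction is a map $T:\mathbb C\to\mathbb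 C$ with $|T(\zeta_1)-T(\zeta_2)|\le|\zeta_1-\zeta_2|$ for all $\zeta_1,\zeta_2$ and $T(0)=0$. A Dirichlet space in the sense of Beurling–Deny is a Hilbert space $D$, with norm $\|\cdot\|$, of complex-valued functions on $\mathbb T$, locally integrable with respect to $m$, such that: (i) for each compact $K\subset\mathbb T$ there is a constant $A(K)>0$ with $\int_K|f|\,dm\le A(K)\|f\|$ for all $f\in D$; (ii) for every normalized contraction $T$ of $\mathbb C$ and every $f\in D$, one has $Tf:=T\circ f\in D$ and $\|Tf\|\le\|f\|$. *)

theory Defs
  imports "HOL-Analysis.Analysis"
begin

section \<open>The spaces \<open>\<D>\<^sup>h(\<omega>)\<close>\<close>

text \<open>
  Functions on the unit circle are represented by functions on \<^typ>\<open>complex\<close> whose values off the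
  circle are irrelevant (every notion below only sees the circle). Elements of \<open>L\<^sup>2(\<T>)\<close> are
  handled through their Borel representatives, without passing to a quotient type.
\<close>

definition circle_measure :: "complex measure" where
  "circle_measure =
     distr (uniform_measure lborel {0..<2 * pi}) (restrict_space borel (sphere 0 1)) cis"

definition disk_area :: "complex measure" where
  "disk_area = uniform_measure (lebesgue_on (ball 0 1)) (ball 0 1)"

definition weight :: "(complex \<Rightarrow> real) \<Rightarrow> bool" where
  "weight \<omega> \<longleftrightarrow> (\<forall>z\<in>ball 0 1. 0 \<le> \<omega> z) \<and> \<omega> \<in> borel_measurable disk_area
     \<and> (\<integral>\<^sup>+z. ennreal (\<omega> z) \<partial>disk_area) < \<infinity>"

definition circle_L2 :: "(complex \<Rightarrow> complex) set" where
  "circle_L2 = {f \<in> borel_measurable circle_measure.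
     integrable circle_measure (\<lambda>\<zeta>. (cmod (f \<zeta>))\<^sup>2)}"

definition circle_inner :: "(complex \<Rightarrow> complex) \<Rightarrow> (complex \<Rightarrow> complex) \<Rightarrow> complex" where
  "circle_inner f g = (LINT \<zeta>|circle_measure. f \<zeta> * cnj (g \<zeta>))"

definition poisson_extension :: "(complex \<Rightarrow> complex) \<Rightarrow> complex \<Rightarrow> complex" where
  "poisson_extension f z =
     (LINT \<zeta>|circle_measure.
        complex_of_real ((1 - (cmod z)\<^sup>2) / (cmod (\<zeta> - z))\<^sup>2) * f \<zeta>)"

text \<open>
  The Wirtinger derivatives \<open>(\<partial>\<^sub>x u - \<i> \<partial>\<^sub>y u) / 2\<close> and
  \<open>(\<partial>\<^sub>x u + \<i> \<partial>\<^sub>y u) / 2\<close>: the real directions \<open>x\<close> and \<open>y\<close> are \<open>1\<close> and \<open>\<i>\<close>.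
\<close>

definition wirtinger :: "(complex \<Rightarrow> complex) \<Rightarrow> complex \<Rightarrow> complex" where
  "wirtinger u z =
     (frechet_derivative u (at z) 1 - \<i> * frechet_derivative u (at z) \<i>) / 2"

definition wirtinger_bar :: "(complex \<Rightarrow> complex) \<Rightarrow> complex \<Rightarrow> complex" where
  "wirtinger_bar u z =
     (frechet_derivative u (at z) 1 + \<i> * frechet_derivative u (at z) \<i>) / 2"

definition dirichlet_form ::
    "(complex \<Rightarrow> real) \<Rightarrow> (complex \<Rightarrow> complex) \<Rightarrow> (complex \<Rightarrow> complex) \<Rightarrow> complex" where
  "dirichlet_form \<omega> f g =
     (LINT z|disk_area.
        (wirtinger (poisson_extension f) z * cnj (wirtinger (poisson_extension g) z)
         + wirtinger_bar (poisson_extension f) z * cnj (wirtinger_bar (poisson_extension g) z))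
        * complex_of_real (\<omega> z))"

text \<open>The diagonal values \<open>\<E>\<^sub>\<omega>(f,f)\<close>, as an integral with values in \<open>[0,\<infinity>]\<close>.\<close>

definition dirichlet_energy :: "(complex \<Rightarrow> real) \<Rightarrow> (complex \<Rightarrow> complex) \<Rightarrow> ennreal" where
  "dirichlet_energy \<omega> f =
     (\<integral>\<^sup>+z. ennreal (((cmod (wirtinger (poisson_extension f) z))\<^sup>2
                  + (cmod (wirtinger_bar (poisson_extension f) z))\<^sup>2) * \<omega> z) \<partial>disk_area)"

definition harmonic_dirichlet :: "(complex \<Rightarrow> real) \<Rightarrow> (complex \<Rightarrow> complex) set" where
  "harmonic_dirichlet \<omega> = {f \<in> circle_L2. dirichlet_energy \<omega> f < \<infinity>}"

definition harmonic_dirichlet_inner ::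
    "(complex \<Rightarrow> real) \<Rightarrow> (complex \<Rightarrow> complex) \<Rightarrow> (complex \<Rightarrow> complex) \<Rightarrow> complex" where
  "harmonic_dirichlet_inner \<omega> f g = circle_inner f g + dirichlet_form \<omega> f g"


section \<open>Douglas weights\<close>

definition off_diagonal :: "(complex \<times> complex) set" where
  "off_diagonal = {(\<zeta>, \<eta>). \<zeta> \<in> sphere 0 1 \<and> \<eta> \<in> sphere 0 1 \<and> \<zeta> \<noteq> \<eta>}"

definition douglas_integral ::
    "(complex \<times> complex) measure \<Rightarrow> (complex \<Rightarrow> complex) \<Rightarrow> ennreal" where
  "douglas_integral J f = (\<integral>\<^sup>+(\<zeta>, \<eta>). ennreal ((cmod (f \<zeta> - f \<eta>))\<^sup>2) \<partial>J)"

text \<open>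
  The energy \<open>\<E>\<^sub>\<omega>(f,f)\<close> only depends on the class of \<open>f\<close> in \<open>L\<^sup>2(\<T>)\<close>, but the double integral
  against \<open>J\<close> may depend on the representative, because a marginal of \<open>J\<close> can charge null sets of
  the circle. (For the Poisson kernel of a point \<open>\<zeta>\<^sub>0\<close> of the circle, \<open>J\<close> lives on
  \<open>{\<zeta>\<^sub>0} \<times> \<T>\<close> and \<open>f(\<zeta>\<^sub>0)\<close> has to be understood as a boundary value.) The double integral of a
  class is therefore taken to be the least value over its Borel representatives. If the
  formula holds for every square-integrable Borel function, the infimum is over a single value:
  see \<open>douglas_weightI\<close> below.
\<close>

definition douglas_form ::
    "(complex \<times> complex) measure \<Rightarrow> (complex \<Rightarrow> complex) \<Rightarrow> ennreal" where
  "douglas_form J f =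
     (INF g\<in>{g \<in> borel_measurable circle_measure. AE \<zeta> in circle_measure. g \<zeta> = f \<zeta>}.
        douglas_integral J g)"

definition douglas_weight :: "(complex \<Rightarrow> real) \<Rightarrow> bool" where
  "douglas_weight \<omega> \<longleftrightarrow> weight \<omega> \<and>
     (\<exists>J. sets J = sets (restrict_space borel off_diagonal) \<and>
          (\<forall>f\<in>circle_L2. dirichlet_energy \<omega> f = douglas_form J f))"

lemma poisson_extension_cong_AE:
  assumes "f \<in> borel_measurable circle_measure" "g \<in> borel_measurable circle_measure"
    and "AE \<zeta> in circle_measure. g \<zeta> = f \<zeta>"
  shows "poisson_extension g = poisson_extension f"
proof
  fix z
  have [measurable]: "(\<lambda>\<zeta>. \<zeta>) \<in> borel_measurable circle_measure"
    unfolding circle_measure_def by (simp add: measurable_restrict_space1)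
  note assms(1,2)[measurable]
  show "poisson_extension g z = poisson_extension f z"
    unfolding poisson_extension_def
    by (rule integral_cong_AE) (use assms(3) in auto)
qed

lemma circle_L2_cong_AE:
  assumes "f \<in> circle_L2" "g \<in> borel_measurable circle_measure"
    and "AE \<zeta> in circle_measure. g \<zeta> = f \<zeta>"
  shows "g \<in> circle_L2"
proof -
  have [measurable]: "f \<in> borel_measurable circle_measure"
    using assms(1) by (simp add: circle_L2_def)
  note assms(2)[measurable]
  have "integrable circle_measure (\<lambda>\<zeta>. (cmod (g \<zeta>))\<^sup>2)
      \<longleftrightarrow> integrable circle_measure (\<lambda>\<zeta>. (cmod (f \<zeta>))\<^sup>2)"
    by (rule integrable_cong_AE) (use assms(3) in auto)
  then show ?thesis
    using assms by (simp add: circle_L2_def)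
qed

lemma douglas_weightI:
  assumes "weight \<omega>" "sets J = sets (restrict_space borel off_diagonal)"
    and *: "\<And>f. f \<in> circle_L2 \<Longrightarrow> dirichlet_energy \<omega> f = douglas_integral J f"
  shows "douglas_weight \<omega>"
proof -
  have "dirichlet_energy \<omega> f = douglas_form J f" if f: "f \<in> circle_L2" for f
  proof -
    let ?R = "{g \<in> borel_measurable circle_measure. AE \<zeta> in circle_measure. g \<zeta> = f \<zeta>}"
    have fm: "f \<in> borel_measurable circle_measure"
      using f by (simp add: circle_L2_def)
    have "douglas_integral J g = dirichlet_energy \<omega> f" if "g \<in> ?R" for g
    proof -
      have "poisson_extension g = poisson_extension f"
        by (rule poisson_extension_cong_AE) (use fm that in auto)
      moreover have "g \<in> circle_L2"
        using circle_L2_cong_AE[OF f] that by auto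
      ultimately show ?thesis
        using *[of g] by (simp add: dirichlet_energy_def)
    qed
    moreover have "f \<in> ?R"
      using fm by simp
    ultimately have "(INF g\<in>?R. douglas_integral J g) = (INF g\<in>?R. dirichlet_energy \<omega> f)"
      by (intro INF_cong) auto
    also have "\<dots> = dirichlet_energy \<omega> f"
      by (rule cINF_const) (use \<open>f \<in> ?R\<close> in blast)
    finally show ?thesis
      by (simp add: douglas_form_def)
  qed
  with assms(1,2) show ?thesis
    unfolding douglas_weight_def by blast
qed


section \<open>Dirichlet spaces in the sense of Beurling and Deny\<close>

definition normalized_contraction :: "(complex \<Rightarrow> complex) \<Rightarrow> bool" where
  "normalized_contraction T \<longleftrightarrow>
     (\<forall>\<zeta>\<^sub>1 \<zeta>\<^sub>2. cmod (T \<zeta>\<^sub>1 - T \<zeta>\<^sub>2) \<le> cmod (\<zeta>\<^sub>1 - \<zeta>\<^sub>2)) \<and> T 0 = 0"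

definition inner_norm ::
    "((complex \<Rightarrow> complex) \<Rightarrow> (complex \<Rightarrow> complex) \<Rightarrow> complex) \<Rightarrow> (complex \<Rightarrow> complex) \<Rightarrow> real" where
  "inner_norm ip f = sqrt (Re (ip f f))"

text \<open>
  A complex Hilbert space of functions on the circle, functions that agree almost everywhere
  being identified: the set is saturated for this relation, the inner product respects it, and
  definiteness is up to it. The inner product is linear in its first argument.
\<close>

definition hilbert_function_space ::
    "(complex \<Rightarrow> complex) set \<Rightarrow>
     ((complex \<Rightarrow> complex) \<Rightarrow> (complex \<Rightarrow> complex) \<Rightarrow> complex) \<Rightarrow> bool" where
  "hilbert_function_space D ip \<longleftrightarrow>
     D \<subseteq> borel_measurable circle_measure \<and>
     (\<forall>f\<in>D. \<forall>g\<in>borel_measurable circle_measure.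
        (AE \<zeta> in circle_measure. g \<zeta> = f \<zeta>) \<longrightarrow> g \<in> D \<and> (\<forall>h\<in>D. ip g h = ip f h)) \<and>
     (\<lambda>\<zeta>. 0) \<in> D \<and>
     (\<forall>f\<in>D. \<forall>g\<in>D. (\<lambda>\<zeta>. f \<zeta> + g \<zeta>) \<in> D) \<and>
     (\<forall>c. \<forall>f\<in>D. (\<lambda>\<zeta>. c * f \<zeta>) \<in> D) \<and>
     (\<forall>f\<in>D. \<forall>g\<in>D. \<forall>h\<in>D. ip (\<lambda>\<zeta>. f \<zeta> + g \<zeta>) h = ip f h + ip g h) \<and>
     (\<forall>c. \<forall>f\<in>D. \<forall>g\<in>D. ip (\<lambda>\<zeta>. c * f \<zeta>) g = c * ip f g) \<and>
     (\<forall>f\<in>D. \<forall>g\<in>D. ip g f = cnj (ip f g)) \<and>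
     (\<forall>f\<in>D. 0 \<le> Re (ip f f)) \<and>
     (\<forall>f\<in>D. ip f f = 0 \<longrightarrow> (AE \<zeta> in circle_measure. f \<zeta> = 0)) \<and>
     (\<forall>F. (\<forall>n::nat. F n \<in> D) \<and>
          (\<forall>\<epsilon>>0. \<exists>N. \<forall>m\<ge>N. \<forall>n\<ge>N. inner_norm ip (\<lambda>\<zeta>. F m \<zeta> - F n \<zeta>) < \<epsilon>)
        \<longrightarrow> (\<exists>f\<in>D. (\<lambda>n. inner_norm ip (\<lambda>\<zeta>. F n \<zeta> - f \<zeta>)) \<longlonglongrightarrow> 0))"

definition beurling_deny_space ::
    "(complex \<Rightarrow> complex) set \<Rightarrow>
     ((complex \<Rightarrow> complex) \<Rightarrow> (complex \<Rightarrow> complex) \<Rightarrow> complex) \<Rightarrow> bool" where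
  "beurling_deny_space D ip \<longleftrightarrow>
     hilbert_function_space D ip \<and>
     (\<forall>K. compact K \<and> K \<subseteq> sphere 0 1 \<longrightarrow>
        (\<forall>f\<in>D. set_integrable circle_measure K f) \<and>
        (\<exists>A>0. \<forall>f\<in>D. (LINT \<zeta>:K|circle_measure. cmod (f \<zeta>)) \<le> A * inner_norm ip f)) \<and>
     (\<forall>T. normalized_contraction T \<longrightarrow>
        (\<forall>f\<in>D. T \<circ> f \<in> D \<and> inner_norm ip (T \<circ> f) \<le> inner_norm ip f))"

end

theory Submission
  imports Defs "HOL-Probability.Probability_Measure"
begin

text \<open>
  The space is complete because of a representation of the gradient, and contractions operate on it
  because of the Douglas formula.

  On the disk the Poisson kernel splits as
  \<open>\<zeta> / (\<zeta> - z) + cnj (\<zeta> / (\<zeta> - z)) - 1\<close>. Hence \<open>P[f]\<close> is, up to a constant, the sum of a holomorphic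
  Cauchy integral and a conjugate one, and both \<open>\<partial>P[f]\<close> and its conjugate counterpart are integrals of
  \<open>f\<close> against kernels that are bounded on the circle for fixed \<open>z\<close>
  (\<open>wirtinger_poisson_extension\<close>). Two consequences are drawn. First, the gradient is linear in \<open>f\<close>,
  so \<open>\<langle>f, g\<rangle>\<close> is a sum of three \<open>L\<^sup>2\<close> inner products, one on the circle and two on the disk
  with the measure \<open>\<omega> dA\<close> (\<open>harmonic_dirichlet_inner_eq\<close>), and the algebraic axioms of a Hilbert
  space follow. Second, the gradient at each point of the disk is continuous for \<open>L\<^sup>1\<close> convergence
  on the circle (\<open>cauchy_transform_deriv_tendsto\<close>).

  For completeness (\<open>harmonic_dirichlet_complete\<close>), a Cauchy sequence is Cauchy in \<open>L\<^sup>1\<close> of the circle,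
  so a subsequence converges almost everywhere to some \<open>f\<close>. Fatou's lemma on the circle puts \<open>f\<close> into
  \<open>L\<^sup>2\<close> and gives convergence there, hence pointwise convergence of the gradients; Fatou's lemma
  on the disk then bounds the energy of \<open>F n - f\<close> by the energies of \<open>F n - F m\<close> for large \<open>m\<close>.

  The local integrability bound holds with constant \<open>1\<close>, since the circle has mass \<open>1\<close>. Finally,
  a normalized contraction \<open>T\<close> does not increase \<open>\<bar>f\<bar>\<close> at any point, because \<open>T 0 = 0\<close>, nor any of the
  differences \<open>\<bar>f \<zeta> - f \<eta>\<bar>\<close>. So it does not increase the energy, which the Douglas formula expresses by
  these differences alone (\<open>douglas_form_contraction\<close>).
\<close>

section \<open>Square-integrable functions\<close>

definition square_integrable :: "'a measure \<Rightarrow> ('a \<Rightarrow> complex) set" where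
  "square_integrable M = {f \<in> borel_measurable M. integrable M (\<lambda>x. (cmod (f x))\<^sup>2)}"

definition L2_inner :: "'a measure \<Rightarrow> ('a \<Rightarrow> complex) \<Rightarrow> ('a \<Rightarrow> complex) \<Rightarrow> complex" where
  "L2_inner M f g = (LINT x|M. f x * cnj (g x))"

lemma square_integrableD:
  assumes "f \<in> square_integrable M"
  shows "f \<in> borel_measurable M" "integrable M (\<lambda>x. (cmod (f x))\<^sup>2)"
  using assms by (auto simp: square_integrable_def)

lemma square_integrable_iff_nn_integral:
  "f \<in> square_integrable M \<longleftrightarrow>
     f \<in> borel_measurable M \<and> (\<integral>\<^sup>+x. ennreal ((cmod (f x))\<^sup>2) \<partial>M) < \<infinity>"
  by (auto simp: square_integrable_def integrable_iff_bounded)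

lemma square_integrable_dominated:
  assumes "f \<in> square_integrable M" "g \<in> borel_measurable M"
    and "\<And>x. x \<in> space M \<Longrightarrow> cmod (g x) \<le> cmod (f x)"
  shows "g \<in> square_integrable M"
proof -
  note assms(2)[measurable]
  have "integrable M (\<lambda>x. (cmod (g x))\<^sup>2)"
    by (rule Bochner_Integration.integrable_bound[OF square_integrableD(2)[OF assms(1)]])
       (auto intro!: power_mono assms(3))
  with assms(2) show ?thesis
    by (simp add: square_integrable_def)
qed

lemma borel_measurable_cnj [measurable]: "cnj \<in> borel_measurable borel"
  by (intro borel_measurable_continuous_onI continuous_intros)

lemma square_integrable_zero: "(\<lambda>x. 0) \<in> square_integrable M"
  by (simp add: square_integrable_def)

lemma square_integrable_scale:
  assumes "f \<in> square_integrable M"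
  shows "(\<lambda>x. c * f x) \<in> square_integrable M"
  using square_integrableD[OF assms]
  by (auto simp: square_integrable_def norm_mult power_mult_distrib)

lemma square_integrable_add:
  assumes "f \<in> square_integrable M" "g \<in> square_integrable M"
  shows "(\<lambda>x. f x + g x) \<in> square_integrable M"
proof -
  note meas = square_integrableD(1)[OF assms(1), measurable] square_integrableD(1)[OF assms(2), measurable]
  have "integrable M (\<lambda>x. 2 * (cmod (f x))\<^sup>2 + 2 * (cmod (g x))\<^sup>2)"
    using square_integrableD(2)[OF assms(1)] square_integrableD(2)[OF assms(2)] by auto
  then have "integrable M (\<lambda>x. (cmod (f x + g x))\<^sup>2)"
  proof (rule Bochner_Integration.integrable_bound)
    have "(cmod (a + b))\<^sup>2 \<le> 2 * (cmod a)\<^sup>2 + 2 * (cmod b)\<^sup>2" for a b :: complex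
    proof -
      have "(cmod (a + b))\<^sup>2 \<le> (cmod a + cmod b)\<^sup>2"
        by (simp add: norm_triangle_ineq power_mono)
      also have "\<dots> \<le> 2 * (cmod a)\<^sup>2 + 2 * (cmod b)\<^sup>2"
        using zero_le_power2[of "cmod a - cmod b"] by (simp add: power2_sum power2_diff)
      finally show ?thesis .
    qed
    then show "AE x in M. norm ((cmod (f x + g x))\<^sup>2) \<le> norm (2 * (cmod (f x))\<^sup>2 + 2 * (cmod (g x))\<^sup>2)"
      by auto
  qed measurable
  then show ?thesis
    by (simp add: square_integrable_def)
qed

lemma square_integrable_diff:
  assumes "f \<in> square_integrable M" "g \<in> square_integrable M"
  shows "(\<lambda>x. f x - g x) \<in> square_integrable M"
  using square_integrable_add[OF assms(1) square_integrable_scale[OF assms(2), of "-1"]] by simp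

lemma integrable_mult_cnj:
  assumes "f \<in> square_integrable M" "g \<in> square_integrable M"
  shows "integrable M (\<lambda>x. f x * cnj (g x))"
proof -
  note [measurable] = square_integrableD(1)[OF assms(1)] square_integrableD(1)[OF assms(2)]
  have "integrable M (\<lambda>x. (cmod (f x))\<^sup>2 + (cmod (g x))\<^sup>2)"
    using square_integrableD(2)[OF assms(1)] square_integrableD(2)[OF assms(2)] by auto
  then show ?thesis
  proof (rule Bochner_Integration.integrable_bound)
    have "cmod a * cmod b \<le> (cmod a)\<^sup>2 + (cmod b)\<^sup>2" for a b :: complex
      using zero_le_power2[of "cmod a - cmod b"] mult_nonneg_nonneg[OF norm_ge_zero norm_ge_zero, of a b]
      unfolding power2_diff by linarith
    then show "AE x in M. norm (f x * cnj (g x)) \<le> norm ((cmod (f x))\<^sup>2 + (cmod (g x))\<^sup>2)"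
      by (auto simp: norm_mult)
  qed measurable
qed

lemma L2_inner_add_left:
  assumes "f \<in> square_integrable M" "g \<in> square_integrable M" "h \<in> square_integrable M"
  shows "L2_inner M (\<lambda>x. f x + g x) h = L2_inner M f h + L2_inner M g h"
  using integrable_mult_cnj[OF assms(1,3)] integrable_mult_cnj[OF assms(2,3)]
  by (simp add: L2_inner_def ring_distribs)

lemma L2_inner_scale_left: "L2_inner M (\<lambda>x. c * f x) g = c * L2_inner M f g"
  by (simp add: L2_inner_def mult.assoc)

lemma L2_inner_commute: "L2_inner M g f = cnj (L2_inner M f g)"
  by (simp add: L2_inner_def mult.commute flip: Bochner_Integration.integral_cnj)

lemma L2_inner_self: "L2_inner M f f = of_real (LINT x|M. (cmod (f x))\<^sup>2)"
  by (simp add: L2_inner_def flip: integral_complex_of_real complex_norm_square)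

text \<open>
  Lower semicontinuity of the norm, by Fatou's lemma. The limit is only assumed measurable, so the
  lemma can be applied to a limit that is so far known only almost everywhere.
\<close>

lemma square_integrable_limit:
  assumes "\<And>k. g k \<in> square_integrable M" "h \<in> borel_measurable M"
    and lim: "AE x in M. (\<lambda>k. g k x) \<longlonglongrightarrow> h x"
    and le: "\<And>k. (LINT x|M. (cmod (g k x))\<^sup>2) \<le> c"
  shows "h \<in> square_integrable M" "(LINT x|M. (cmod (h x))\<^sup>2) \<le> c"
proof -
  note [measurable] = square_integrableD(1)[OF assms(1)] assms(2)
  have c: "0 \<le> c"
  proof -
    have "0 \<le> (LINT x|M. (cmod (g 0 x))\<^sup>2)"
      by (auto intro!: integral_nonneg_AE)
    then show ?thesis
      using le[of 0] by (rule order_trans)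
  qed
  have "(\<integral>\<^sup>+x. ennreal ((cmod (h x))\<^sup>2) \<partial>M)
      \<le> (\<integral>\<^sup>+x. liminf (\<lambda>k. ennreal ((cmod (g k x))\<^sup>2)) \<partial>M)"
  proof (rule nn_integral_mono_AE)
    show "AE x in M. ennreal ((cmod (h x))\<^sup>2) \<le> liminf (\<lambda>k. ennreal ((cmod (g k x))\<^sup>2))"
      using lim
    proof eventually_elim
      case (elim x)
      then have "(\<lambda>k. ennreal ((cmod (g k x))\<^sup>2)) \<longlonglongrightarrow> ennreal ((cmod (h x))\<^sup>2)"
        by (intro tendsto_intros)
      then show ?case
        using lim_imp_Liminf[OF sequentially_bot] by fastforce
    qed
  qed
  also have "\<dots> \<le> liminf (\<lambda>k. \<integral>\<^sup>+x. ennreal ((cmod (g k x))\<^sup>2) \<partial>M)"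
    by (rule nn_integral_liminf) measurable
  also have "\<dots> \<le> ennreal c"
  proof -
    have "(\<integral>\<^sup>+x. ennreal ((cmod (g k x))\<^sup>2) \<partial>M) \<le> ennreal c" for k
      using le[of k] square_integrableD(2)[OF assms(1)[of k]]
      by (subst nn_integral_eq_integral) (auto intro: ennreal_leI)
    then have "liminf (\<lambda>k. \<integral>\<^sup>+x. ennreal ((cmod (g k x))\<^sup>2) \<partial>M) \<le> liminf (\<lambda>k::nat. ennreal c)"
      by (intro Liminf_mono) auto
    then show ?thesis
      by (simp add: Liminf_const)
  qed
  finally have fin: "(\<integral>\<^sup>+x. ennreal ((cmod (h x))\<^sup>2) \<partial>M) \<le> ennreal c" .
  then show "h \<in> square_integrable M"
    using assms(2) by (auto simp: square_integrable_iff_nn_integral intro: le_less_trans)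
  show "(LINT x|M. (cmod (h x))\<^sup>2) \<le> c"
    using fin c by (intro integral_real_bounded)
qed

text \<open>On a probability space the first moment is controlled by the second: variance is nonnegative.\<close>

lemma (in prob_space) L1_norm_le_L2_norm:
  assumes "f \<in> square_integrable M"
  shows "integrable M f" "(LINT x|M. cmod (f x))\<^sup>2 \<le> (LINT x|M. (cmod (f x))\<^sup>2)"
proof -
  note [measurable] = square_integrableD(1)[OF assms]
  have "integrable M (\<lambda>x. 1 + (cmod (f x))\<^sup>2)"
    using square_integrableD(2)[OF assms] by auto
  then show int: "integrable M f"
  proof (rule Bochner_Integration.integrable_bound)
    have "cmod a \<le> 1 + (cmod a)\<^sup>2" for a :: complex
      using zero_le_power2[of "cmod a - 1"] norm_ge_zero[of a]
      unfolding power2_diff power_one by linarith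
    then show "AE x in M. norm (f x) \<le> norm (1 + (cmod (f x))\<^sup>2)"
      by auto
  qed measurable
  show "(LINT x|M. cmod (f x))\<^sup>2 \<le> (LINT x|M. (cmod (f x))\<^sup>2)"
    using variance_eq[OF integrable_norm[OF int] square_integrableD(2)[OF assms]]
      variance_positive[of "\<lambda>x. cmod (f x)"] by simp
qed


section \<open>Derivatives of the Poisson extension\<close>

lemma prob_space_circle_measure: "prob_space circle_measure"
proof -
  interpret U: prob_space "uniform_measure lborel {0..<2 * pi}"
    by (rule prob_space_uniform_measure) (auto simp: not_le)
  have "cis \<in> borel_measurable borel"
    by (intro borel_measurable_continuous_onI continuous_intros)
  then show ?thesis
    unfolding circle_measure_def
    by (intro U.prob_space_distr) (auto intro!: measurable_restrict_space2)
qed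

interpretation circle: prob_space circle_measure
  by (rule prob_space_circle_measure)

lemma space_circle_measure: "space circle_measure = sphere 0 1"
  by (simp add: circle_measure_def space_restrict_space)

lemma measurable_circle_measure_id [measurable]: "(\<lambda>\<zeta>. \<zeta>) \<in> borel_measurable circle_measure"
  by (simp add: circle_measure_def measurable_restrict_space1)

text \<open>
  All kernels below are bounded on the circle for fixed \<open>z\<close> in the disk. With this, an integral
  against such a kernel is a continuous functional on \<open>L\<^sup>1\<close> of the circle.
\<close>

lemma integrable_circle_mult_bounded:
  assumes "integrable circle_measure f" "k \<in> borel_measurable circle_measure"
    and "\<And>\<zeta>. cmod \<zeta> = 1 \<Longrightarrow> cmod (k \<zeta>) \<le> B"
  shows "integrable circle_measure (\<lambda>\<zeta>. f \<zeta> * k \<zeta>)"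
    and "cmod (LINT \<zeta>|circle_measure. f \<zeta> * k \<zeta>) \<le> B * (LINT \<zeta>|circle_measure. cmod (f \<zeta>))"
proof -
  note [measurable] = borel_measurable_integrable[OF assms(1)] assms(2)
  have le: "cmod (f \<zeta> * k \<zeta>) \<le> B * cmod (f \<zeta>)" if "\<zeta> \<in> space circle_measure" for \<zeta>
    using mult_right_mono[OF assms(3), of \<zeta> "cmod (f \<zeta>)"] that
    by (simp add: norm_mult space_circle_measure mult.commute)
  have int: "integrable circle_measure (\<lambda>\<zeta>. B * cmod (f \<zeta>))"
    using assms(1) by auto
  show *: "integrable circle_measure (\<lambda>\<zeta>. f \<zeta> * k \<zeta>)"
  proof (rule Bochner_Integration.integrable_bound[OF int])
    show "AE \<zeta> in circle_measure. norm (f \<zeta> * k \<zeta>) \<le> norm (B * cmod (f \<zeta>))"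
      using le by (intro AE_I2) (metis abs_ge_self order_trans real_norm_def)
  qed measurable
  have "cmod (LINT \<zeta>|circle_measure. f \<zeta> * k \<zeta>) \<le> (LINT \<zeta>|circle_measure. B * cmod (f \<zeta>))"
    using * int le by (rule Bochner_Integration.integral_norm_bound_integral)
  then show "cmod (LINT \<zeta>|circle_measure. f \<zeta> * k \<zeta>) \<le> B * (LINT \<zeta>|circle_measure. cmod (f \<zeta>))"
    by simp
qed

definition cauchy_transform :: "(complex \<Rightarrow> complex) \<Rightarrow> complex \<Rightarrow> complex" where
  "cauchy_transform f z = (LINT \<zeta>|circle_measure. f \<zeta> * (\<zeta> / (\<zeta> - z)))"

definition cauchy_transform_deriv :: "(complex \<Rightarrow> complex) \<Rightarrow> complex \<Rightarrow> complex" where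
  "cauchy_transform_deriv f z = (LINT \<zeta>|circle_measure. f \<zeta> * (\<zeta> / (\<zeta> - z)\<^sup>2))"

lemma circle_dist_ge: "cmod \<zeta> = 1 \<Longrightarrow> 1 - cmod z \<le> cmod (\<zeta> - z)"
  using norm_triangle_ineq2[of \<zeta> z] by simp

lemma cauchy_kernel_bound:
  assumes "cmod z < 1" "cmod \<zeta> = 1"
  shows "cmod (\<zeta> / (\<zeta> - z)) \<le> 1 / (1 - cmod z)"
    and "cmod (\<zeta> / (\<zeta> - z)\<^sup>2) \<le> 1 / (1 - cmod z)\<^sup>2"
  using circle_dist_ge[OF assms(2), of z] assms
  by (auto simp: norm_divide norm_power intro!: divide_left_mono power_mono mult_pos_pos)

lemma cauchy_kernel_integrable:
  assumes "integrable circle_measure f" "cmod z < 1"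
  shows "integrable circle_measure (\<lambda>\<zeta>. f \<zeta> * (\<zeta> / (\<zeta> - z)))"
    and "integrable circle_measure (\<lambda>\<zeta>. f \<zeta> * (\<zeta> / (\<zeta> - z)\<^sup>2))"
  by (rule integrable_circle_mult_bounded(1)[OF assms(1)];
      use cauchy_kernel_bound[OF assms(2)] in \<open>measurable | assumption\<close>)+

lemma cauchy_transform_deriv_bound:
  assumes "integrable circle_measure f" "cmod z < 1"
  shows "cmod (cauchy_transform_deriv f z)
           \<le> 1 / (1 - cmod z)\<^sup>2 * (LINT \<zeta>|circle_measure. cmod (f \<zeta>))"
  unfolding cauchy_transform_deriv_def
  by (rule integrable_circle_mult_bounded(2)[OF assms(1)])
     (use cauchy_kernel_bound[OF assms(2)] in \<open>measurable | assumption\<close>)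

lemma cauchy_transform_deriv_add:
  assumes "integrable circle_measure f" "integrable circle_measure g" "cmod z < 1"
  shows "cauchy_transform_deriv (\<lambda>\<zeta>. f \<zeta> + g \<zeta>) z
           = cauchy_transform_deriv f z + cauchy_transform_deriv g z"
  using cauchy_kernel_integrable(2)[OF assms(1,3)] cauchy_kernel_integrable(2)[OF assms(2,3)]
  by (simp add: cauchy_transform_deriv_def distrib_right del: times_divide_eq_right)

lemma cauchy_transform_deriv_scale:
  "cauchy_transform_deriv (\<lambda>\<zeta>. c * f \<zeta>) z = c * cauchy_transform_deriv f z"
  by (simp add: cauchy_transform_deriv_def mult.assoc del: times_divide_eq_right)

text \<open>Measurability in the parameter \<open>z\<close> is part of Fubini's theorem, as the kernel is jointly measurable.\<close>

lemma cauchy_transform_deriv_measurable: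
  assumes "f \<in> borel_measurable circle_measure"
  shows "cauchy_transform_deriv f \<in> borel_measurable borel"
proof -
  note [measurable] = assms
  show ?thesis
    unfolding cauchy_transform_deriv_def
    by (rule circle.borel_measurable_lebesgue_integral) measurable
qed

text \<open>
  The difference quotient minus the derivative of the kernel is
  \<open>(w - z) * \<zeta> / ((\<zeta> - z)\<^sup>2 (\<zeta> - w))\<close>, which tends to zero uniformly in \<open>\<zeta>\<close> as \<open>w\<close> tends to \<open>z\<close>.
\<close>

lemma DERIV_cauchy_transform:
  assumes f: "integrable circle_measure f" and z: "cmod z < 1"
  shows "(cauchy_transform f has_field_derivative cauchy_transform_deriv f z) (at z)"
proof -
  \<comment> \<open>Points within \<open>d\<close> of \<open>z\<close> still have distance at least \<open>d\<close> from the circle.\<close>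
  define d where "d = (1 - cmod z) / 2"
  define K where "K = 1 / d ^ 3 * (LINT \<zeta>|circle_measure. cmod (f \<zeta>))"
  have d: "0 < d"
    using z by (simp add: d_def)
  have K: "cmod ((cauchy_transform f w - cauchy_transform f z) / (w - z) - cauchy_transform_deriv f z)
             \<le> cmod (w - z) * K" if w: "w \<noteq> z" "dist w z < d" for w
  proof -
    have w1: "cmod w < 1 - d"
      using w(2) norm_triangle_ineq2[of w z] by (simp add: d_def dist_norm field_simps)
    have *: "d \<le> cmod (\<zeta> - w)" "d \<le> cmod (\<zeta> - z)" if "cmod \<zeta> = 1" for \<zeta>
    proof -
      show "d \<le> cmod (\<zeta> - w)"
        using circle_dist_ge[OF that, of w] w1 by linarith
      show "d \<le> cmod (\<zeta> - z)"
        using circle_dist_ge[OF that, of z] z by (simp add: d_def)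
    qed
    define k where "k \<zeta> = \<zeta> / ((\<zeta> - z)\<^sup>2 * (\<zeta> - w))" for \<zeta>
    have w1': "cmod w < 1"
      using w1 d by simp
    have "cmod (k \<zeta>) \<le> 1 / d ^ 3" if "cmod \<zeta> = 1" for \<zeta>
    proof -
      have "d ^ 3 \<le> (cmod (\<zeta> - z))\<^sup>2 * cmod (\<zeta> - w)"
        using mult_mono[OF power_mono[OF *(2)[OF that], of 2] *(1)[OF that]] d
        by (simp add: power3_eq_cube power2_eq_square)
      then show ?thesis
        using d that by (auto simp: k_def norm_divide norm_mult norm_power intro!: divide_left_mono mult_pos_pos)
    qed
    then have bound: "cmod (LINT \<zeta>|circle_measure. f \<zeta> * k \<zeta>) \<le> K"
      unfolding K_def by (intro integrable_circle_mult_bounded(2)[OF f]) (auto simp: k_def)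
    have "(cauchy_transform f w - cauchy_transform f z) / (w - z) - cauchy_transform_deriv f z
        = (LINT \<zeta>|circle_measure. (f \<zeta> * (\<zeta> / (\<zeta> - w)) - f \<zeta> * (\<zeta> / (\<zeta> - z))) / (w - z)
             - f \<zeta> * (\<zeta> / (\<zeta> - z)\<^sup>2))"
      using cauchy_kernel_integrable[OF f z] cauchy_kernel_integrable[OF f w1']
      by (simp add: cauchy_transform_def cauchy_transform_deriv_def)
    also have "\<dots> = (LINT \<zeta>|circle_measure. (w - z) * (f \<zeta> * k \<zeta>))"
    proof (rule Bochner_Integration.integral_cong)
      fix \<zeta> assume "\<zeta> \<in> space circle_measure"
      then have "cmod \<zeta> = 1"
        by (simp add: space_circle_measure)
      then have ne: "\<zeta> - z \<noteq> 0" "\<zeta> - w \<noteq> 0"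
        using *[of \<zeta>] d by auto
      have "(\<zeta> / (\<zeta> - w) - \<zeta> / (\<zeta> - z)) / (w - z) - \<zeta> / (\<zeta> - z)\<^sup>2 = (w - z) * k \<zeta>"
      proof -
        have "\<zeta> / (\<zeta> - w) - \<zeta> / (\<zeta> - z) = (w - z) * (\<zeta> / ((\<zeta> - w) * (\<zeta> - z)))"
          using ne by (simp add: field_simps)
        then have "(\<zeta> / (\<zeta> - w) - \<zeta> / (\<zeta> - z)) / (w - z) = \<zeta> / ((\<zeta> - w) * (\<zeta> - z))"
          using w by simp
        also have "\<dots> - \<zeta> / (\<zeta> - z)\<^sup>2 = (w - z) * k \<zeta>"
        proof -
          have "\<zeta> / (b * a) - \<zeta> / a\<^sup>2 = (a - b) * (\<zeta> / (a\<^sup>2 * b))"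
            if "a \<noteq> 0" "b \<noteq> 0" for a b :: complex
            using that by (simp add: field_simps power2_eq_square)
          from this[OF ne] show ?thesis
            by (simp add: k_def)
        qed
        finally show ?thesis .
      qed
      then have "f \<zeta> * ((\<zeta> / (\<zeta> - w) - \<zeta> / (\<zeta> - z)) / (w - z) - \<zeta> / (\<zeta> - z)\<^sup>2) = f \<zeta> * ((w - z) * k \<zeta>)"
        by simp
      then show "(f \<zeta> * (\<zeta> / (\<zeta> - w)) - f \<zeta> * (\<zeta> / (\<zeta> - z))) / (w - z) - f \<zeta> * (\<zeta> / (\<zeta> - z)\<^sup>2)
          = (w - z) * (f \<zeta> * k \<zeta>)"
        by (simp add: right_diff_distrib mult_ac)
    qed simp
    finally show ?thesis
      using bound by (simp add: norm_mult mult_left_mono)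
  qed
  have "((\<lambda>w. (cauchy_transform f w - cauchy_transform f z) / (w - z) - cauchy_transform_deriv f z)
          \<longlongrightarrow> 0) (at z)"
  proof (rule Lim_null_comparison)
    show "\<forall>\<^sub>F w in at z. norm ((cauchy_transform f w - cauchy_transform f z) / (w - z)
            - cauchy_transform_deriv f z) \<le> cmod (w - z) * K"
      using K d by (auto simp: eventually_at)
    show "((\<lambda>w. cmod (w - z) * K) \<longlongrightarrow> 0) (at z)"
      by (auto intro!: tendsto_eq_intros)
  qed
  then show ?thesis
    unfolding has_field_derivative_iff by (rule LIM_zero_cancel)
qed

text \<open>
  The Poisson kernel is the real part of \<open>(\<zeta> + z) / (\<zeta> - z) = 2 * \<zeta> / (\<zeta> - z) - 1\<close>. Conjugating \<open>f\<close>
  twice writes the antiholomorphic half as the conjugate of a Cauchy integral.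
\<close>

lemma poisson_extension_eq:
  assumes f: "integrable circle_measure f" and z: "cmod z < 1"
  shows "poisson_extension f z =
     cauchy_transform f z + cnj (cauchy_transform (\<lambda>\<zeta>. cnj (f \<zeta>)) z) - (LINT \<zeta>|circle_measure. f \<zeta>)"
proof -
  have f': "integrable circle_measure (\<lambda>\<zeta>. cnj (f \<zeta>))"
    using f by simp
  have int: "integrable circle_measure (\<lambda>\<zeta>. f \<zeta> * (\<zeta> / (\<zeta> - z)))"
    "integrable circle_measure (\<lambda>\<zeta>. cnj (cnj (f \<zeta>) * (\<zeta> / (\<zeta> - z))))"
    using cauchy_kernel_integrable(1)[OF f z] integrable_cnj[OF cauchy_kernel_integrable(1)[OF f' z]]
    by simp_all
  have "poisson_extension f z =
      (LINT \<zeta>|circle_measure. f \<zeta> * (\<zeta> / (\<zeta> - z)) + cnj (cnj (f \<zeta>) * (\<zeta> / (\<zeta> - z))) - f \<zeta>)"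
    unfolding poisson_extension_def
  proof (rule Bochner_Integration.integral_cong)
    fix \<zeta> assume "\<zeta> \<in> space circle_measure"
    then have \<zeta>: "cmod \<zeta> = 1"
      by (simp add: space_circle_measure)
    then have ne: "\<zeta> - z \<noteq> 0" "cnj (\<zeta> - z) \<noteq> 0"
      using circle_dist_ge[OF \<zeta>, of z] z by auto
    \<comment> \<open>Both sides of \<open>num\<close> equal \<open>\<zeta> * cnj \<zeta> - z * cnj z\<close>.\<close>
    have "\<zeta> * cnj \<zeta> = 1"
      using \<zeta> complex_norm_square[of \<zeta>] by simp
    then have num: "complex_of_real (1 - (cmod z)\<^sup>2)
        = \<zeta> * cnj (\<zeta> - z) + cnj \<zeta> * (\<zeta> - z) - (\<zeta> - z) * cnj (\<zeta> - z)"
      using complex_norm_square[of z] by (simp add: algebra_simps)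
    have "complex_of_real ((1 - (cmod z)\<^sup>2) / (cmod (\<zeta> - z))\<^sup>2)
        = (\<zeta> * cnj (\<zeta> - z) + cnj \<zeta> * (\<zeta> - z) - (\<zeta> - z) * cnj (\<zeta> - z))
          / ((\<zeta> - z) * cnj (\<zeta> - z))"
      using num complex_norm_square[of "\<zeta> - z"] by (simp only: of_real_divide)
    also have "\<dots> = \<zeta> / (\<zeta> - z) + cnj \<zeta> / cnj (\<zeta> - z) - 1"
      using ne by (simp add: diff_divide_distrib add_divide_distrib del: complex_cnj_diff)
    finally have eq: "complex_of_real ((1 - (cmod z)\<^sup>2) / (cmod (\<zeta> - z))\<^sup>2)
        = \<zeta> / (\<zeta> - z) + cnj \<zeta> / cnj (\<zeta> - z) - 1" .
    show "complex_of_real ((1 - (cmod z)\<^sup>2) / (cmod (\<zeta> - z))\<^sup>2) * f \<zeta>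
        = f \<zeta> * (\<zeta> / (\<zeta> - z)) + cnj (cnj (f \<zeta>) * (\<zeta> / (\<zeta> - z))) - f \<zeta>"
      unfolding eq by (simp add: algebra_simps)
  qed simp
  also have "\<dots> = cauchy_transform f z + (LINT \<zeta>|circle_measure. cnj (cnj (f \<zeta>) * (\<zeta> / (\<zeta> - z))))
      - (LINT \<zeta>|circle_measure. f \<zeta>)"
    using int f unfolding cauchy_transform_def by (simp del: complex_cnj_mult)
  finally show ?thesis
    by (simp only: cauchy_transform_def Bochner_Integration.integral_cnj)
qed

text \<open>
  The antiholomorphic derivative of \<open>P[f]\<close> (see \<open>wirtinger_poisson_extension\<close>). The two conjugations
  make it complex linear in \<open>f\<close>.
\<close>

definition conj_cauchy_transform_deriv :: "(complex \<Rightarrow> complex) \<Rightarrow> complex \<Rightarrow> complex" where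
  "conj_cauchy_transform_deriv f z = cnj (cauchy_transform_deriv (\<lambda>\<zeta>. cnj (f \<zeta>)) z)"

lemma conj_cauchy_transform_deriv_bound:
  assumes "integrable circle_measure f" "cmod z < 1"
  shows "cmod (conj_cauchy_transform_deriv f z)
           \<le> 1 / (1 - cmod z)\<^sup>2 * (LINT \<zeta>|circle_measure. cmod (f \<zeta>))"
  using cauchy_transform_deriv_bound[of "\<lambda>\<zeta>. cnj (f \<zeta>)" z] assms
  by (simp add: conj_cauchy_transform_deriv_def)

lemma conj_cauchy_transform_deriv_add:
  assumes "integrable circle_measure f" "integrable circle_measure g" "cmod z < 1"
  shows "conj_cauchy_transform_deriv (\<lambda>\<zeta>. f \<zeta> + g \<zeta>) z
           = conj_cauchy_transform_deriv f z + conj_cauchy_transform_deriv g z"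
  using assms cauchy_transform_deriv_add[of "\<lambda>\<zeta>. cnj (f \<zeta>)" "\<lambda>\<zeta>. cnj (g \<zeta>)" z]
  by (simp add: conj_cauchy_transform_deriv_def)

lemma conj_cauchy_transform_deriv_scale:
  "conj_cauchy_transform_deriv (\<lambda>\<zeta>. c * f \<zeta>) z = c * conj_cauchy_transform_deriv f z"
  by (simp add: conj_cauchy_transform_deriv_def cauchy_transform_deriv_scale)

lemma conj_cauchy_transform_deriv_measurable:
  assumes "f \<in> borel_measurable circle_measure"
  shows "conj_cauchy_transform_deriv f \<in> borel_measurable borel"
proof -
  note [measurable] = assms
  have [measurable]: "cauchy_transform_deriv (\<lambda>\<zeta>. cnj (f \<zeta>)) \<in> borel_measurable borel"
    by (rule cauchy_transform_deriv_measurable) measurable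
  show ?thesis
    unfolding conj_cauchy_transform_deriv_def by measurable
qed

text \<open>
  The differential of \<open>P[f]\<close> at \<open>z\<close> is \<open>h \<mapsto> a * h + cnj (b * h)\<close>; the Wirtinger derivatives read off
  its complex linear and its conjugate linear coefficient.
\<close>

lemma wirtinger_poisson_extension:
  assumes f: "integrable circle_measure f" and z: "z \<in> ball 0 1"
  shows "wirtinger (poisson_extension f) z = cauchy_transform_deriv f z"
    and "wirtinger_bar (poisson_extension f) z = conj_cauchy_transform_deriv f z"
proof -
  define a where "a = cauchy_transform_deriv f z"
  define b where "b = cauchy_transform_deriv (\<lambda>\<zeta>. cnj (f \<zeta>)) z"
  have z1: "cmod z < 1"
    using z by simp
  have f': "integrable circle_measure (\<lambda>\<zeta>. cnj (f \<zeta>))"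
    using f by simp
  have "((\<lambda>w. cauchy_transform f w + cnj (cauchy_transform (\<lambda>\<zeta>. cnj (f \<zeta>)) w)
          - (LINT \<zeta>|circle_measure. f \<zeta>)) has_derivative (\<lambda>h. a * h + cnj (b * h))) (at z)"
    using DERIV_cauchy_transform[OF f z1] DERIV_cauchy_transform[OF f' z1]
    unfolding has_field_derivative_def a_def b_def
    by (auto intro!: derivative_eq_intros)
  then have "(poisson_extension f has_derivative (\<lambda>h. a * h + cnj (b * h))) (at z)"
    by (rule has_derivative_transform_within_open[OF _ open_ball z])
       (simp add: poisson_extension_eq[OF f])
  then have "frechet_derivative (poisson_extension f) (at z) = (\<lambda>h. a * h + cnj (b * h))"
    by (rule frechet_derivative_at[symmetric])
  then show "wirtinger (poisson_extension f) z = a" "wirtinger_bar (poisson_extension f) z = conj_cauchy_transform_deriv f z"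
    by (simp_all add: wirtinger_def wirtinger_bar_def conj_cauchy_transform_deriv_def b_def algebra_simps flip: mult.assoc)
qed


text \<open>
  The derivatives at a point of the disk are continuous functionals of \<open>f\<close>, so they pass to \<open>L\<^sup>1\<close> limits pointwise on the disk. This is
  what feeds Fatou's lemma in the proof of completeness.
\<close>

lemma cauchy_transform_deriv_tendsto:
  assumes "integrable circle_measure f" "\<And>k. integrable circle_measure (F k)" "cmod z < 1"
    and lim: "(\<lambda>k. LINT \<zeta>|circle_measure. cmod (F k \<zeta> - f \<zeta>)) \<longlonglongrightarrow> 0"
  shows "(\<lambda>k. cauchy_transform_deriv (F k) z) \<longlonglongrightarrow> cauchy_transform_deriv f z"
    and "(\<lambda>k. conj_cauchy_transform_deriv (F k) z) \<longlonglongrightarrow> conj_cauchy_transform_deriv f z"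
proof -
  have int: "integrable circle_measure (\<lambda>\<zeta>. F k \<zeta> - f \<zeta>)" for k
    using assms(1,2) by simp
  have bound: "(\<lambda>k. 1 / (1 - cmod z)\<^sup>2 * (LINT \<zeta>|circle_measure. cmod (F k \<zeta> - f \<zeta>))) \<longlonglongrightarrow> 0"
    using tendsto_mult_right_zero[OF lim] .
  have "(\<lambda>k. cauchy_transform_deriv (\<lambda>\<zeta>. F k \<zeta> - f \<zeta>) z) \<longlonglongrightarrow> 0"
    by (rule Lim_null_comparison[OF _ bound])
       (use cauchy_transform_deriv_bound[OF int assms(3)] in auto)
  moreover have "cauchy_transform_deriv (F k) z
      = cauchy_transform_deriv (\<lambda>\<zeta>. F k \<zeta> - f \<zeta>) z + cauchy_transform_deriv f z" for k
    using cauchy_transform_deriv_add[OF int assms(1,3), of k] by simp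
  ultimately have "(\<lambda>k. cauchy_transform_deriv (F k) z - cauchy_transform_deriv f z) \<longlonglongrightarrow> 0"
    by simp
  then show "(\<lambda>k. cauchy_transform_deriv (F k) z) \<longlonglongrightarrow> cauchy_transform_deriv f z"
    by (rule LIM_zero_cancel)
  have "(\<lambda>k. conj_cauchy_transform_deriv (\<lambda>\<zeta>. F k \<zeta> - f \<zeta>) z) \<longlonglongrightarrow> 0"
    by (rule Lim_null_comparison[OF _ bound])
       (use conj_cauchy_transform_deriv_bound[OF int assms(3)] in auto)
  moreover have "conj_cauchy_transform_deriv (F k) z
      = conj_cauchy_transform_deriv (\<lambda>\<zeta>. F k \<zeta> - f \<zeta>) z + conj_cauchy_transform_deriv f z" for k
    using conj_cauchy_transform_deriv_add[OF int assms(1,3), of k] by simp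
  ultimately have "(\<lambda>k. conj_cauchy_transform_deriv (F k) z - conj_cauchy_transform_deriv f z) \<longlonglongrightarrow> 0"
    by simp
  then show "(\<lambda>k. conj_cauchy_transform_deriv (F k) z) \<longlonglongrightarrow> conj_cauchy_transform_deriv f z"
    by (rule LIM_zero_cancel)
qed


section \<open>The harmonic Dirichlet space as a Hilbert space\<close>

definition energy_measure :: "(complex \<Rightarrow> real) \<Rightarrow> complex measure" where
  "energy_measure \<omega> = density disk_area (\<lambda>z. ennreal (\<omega> z))"

lemma space_disk_area: "space disk_area = ball 0 1"
  by (simp add: disk_area_def)

lemma space_energy_measure: "space (energy_measure \<omega>) = ball 0 1"
  by (simp add: energy_measure_def space_disk_area)

lemma borel_measurable_disk_areaI:
  fixes f :: "complex \<Rightarrow> complex"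
  assumes "f \<in> borel_measurable borel"
  shows "f \<in> borel_measurable disk_area"
proof -
  have "(borel_measurable disk_area :: (complex \<Rightarrow> complex) set)
      = borel_measurable (lebesgue_on (ball 0 1))"
    unfolding disk_area_def by (rule measurable_cong_sets) simp_all
  moreover have "f \<in> borel_measurable (lebesgue_on (ball 0 1))"
    using assms by (intro measurable_restrict_space1 measurable_completion) simp
  ultimately show ?thesis
    by simp
qed

lemma circle_L2_eq: "circle_L2 = square_integrable circle_measure"
  by (simp add: circle_L2_def square_integrable_def)

lemma circle_inner_eq: "circle_inner = L2_inner circle_measure"
  by (simp add: circle_inner_def L2_inner_def fun_eq_iff)

lemma borel_measurable_energy_measure:
  assumes "f \<in> borel_measurable circle_measure"
  shows "cauchy_transform_deriv f \<in> borel_measurable (energy_measure \<omega>)"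
    and "conj_cauchy_transform_deriv f \<in> borel_measurable (energy_measure \<omega>)"
  using borel_measurable_disk_areaI[OF cauchy_transform_deriv_measurable[OF assms]]
    borel_measurable_disk_areaI[OF conj_cauchy_transform_deriv_measurable[OF assms]]
  by (simp_all add: energy_measure_def)

lemma dirichlet_energy_eq:
  assumes \<omega>: "weight \<omega>" and f: "integrable circle_measure f"
  shows "dirichlet_energy \<omega> f =
     (\<integral>\<^sup>+z. ennreal ((cmod (cauchy_transform_deriv f z))\<^sup>2) \<partial>energy_measure \<omega>)
     + (\<integral>\<^sup>+z. ennreal ((cmod (conj_cauchy_transform_deriv f z))\<^sup>2) \<partial>energy_measure \<omega>)"
proof -
  note f' = borel_measurable_integrable[OF f]
  have [measurable]: "\<omega> \<in> borel_measurable disk_area"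
    "cauchy_transform_deriv f \<in> borel_measurable disk_area"
    "conj_cauchy_transform_deriv f \<in> borel_measurable disk_area"
    using \<omega> f' by (auto simp: weight_def intro!: borel_measurable_disk_areaI
        cauchy_transform_deriv_measurable conj_cauchy_transform_deriv_measurable)
  have "dirichlet_energy \<omega> f = (\<integral>\<^sup>+z. ennreal (\<omega> z) * ennreal ((cmod (cauchy_transform_deriv f z))\<^sup>2)
      + ennreal (\<omega> z) * ennreal ((cmod (conj_cauchy_transform_deriv f z))\<^sup>2) \<partial>disk_area)"
    unfolding dirichlet_energy_def
  proof (rule nn_integral_cong)
    fix z assume "z \<in> space disk_area"
    then have z: "z \<in> ball 0 1"
      by (simp add: space_disk_area)
    then have "0 \<le> \<omega> z"
      using \<omega> by (auto simp: weight_def)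
    then show "ennreal (((cmod (wirtinger (poisson_extension f) z))\<^sup>2
          + (cmod (wirtinger_bar (poisson_extension f) z))\<^sup>2) * \<omega> z)
        = ennreal (\<omega> z) * ennreal ((cmod (cauchy_transform_deriv f z))\<^sup>2)
          + ennreal (\<omega> z) * ennreal ((cmod (conj_cauchy_transform_deriv f z))\<^sup>2)"
      by (simp add: wirtinger_poisson_extension[OF f z] distrib_left mult.commute
          flip: ennreal_mult ennreal_plus)
  qed
  then show ?thesis
    by (simp add: energy_measure_def nn_integral_density nn_integral_add)
qed

lemma circle_L2_integrable: "f \<in> circle_L2 \<Longrightarrow> integrable circle_measure f"
  by (simp add: circle_L2_eq circle.L1_norm_le_L2_norm(1))

text \<open>
  The map that sends \<open>f\<close> to \<open>f\<close> and its two derivatives embeds \<open>\<D>\<^sup>h(\<omega>)\<close> into a product of three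
  \<open>L\<^sup>2\<close> spaces; linear structure and inner product are inherited from there.
\<close>

lemma harmonic_dirichlet_iff:
  assumes "weight \<omega>"
  shows "f \<in> harmonic_dirichlet \<omega> \<longleftrightarrow> f \<in> square_integrable circle_measure
     \<and> cauchy_transform_deriv f \<in> square_integrable (energy_measure \<omega>)
     \<and> conj_cauchy_transform_deriv f \<in> square_integrable (energy_measure \<omega>)"
proof (cases "f \<in> circle_L2")
  case True
  then have "f \<in> borel_measurable circle_measure"
    by (simp add: circle_L2_def)
  with True show ?thesis
    by (simp add: harmonic_dirichlet_def dirichlet_energy_eq[OF assms circle_L2_integrable[OF True]]
        square_integrable_iff_nn_integral[of _ "energy_measure \<omega>"] borel_measurable_energy_measure
        flip: circle_L2_eq)
next
  case False
  then show ?thesis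
    by (simp add: harmonic_dirichlet_def circle_L2_eq)
qed

lemma harmonic_dirichletD:
  assumes "weight \<omega>" "f \<in> harmonic_dirichlet \<omega>"
  shows "f \<in> square_integrable circle_measure" "integrable circle_measure f"
    "cauchy_transform_deriv f \<in> square_integrable (energy_measure \<omega>)"
    "conj_cauchy_transform_deriv f \<in> square_integrable (energy_measure \<omega>)"
  using assms by (auto simp: harmonic_dirichlet_iff circle.L1_norm_le_L2_norm(1))

lemma harmonic_dirichlet_inner_eq:
  assumes \<omega>: "weight \<omega>" and f: "f \<in> harmonic_dirichlet \<omega>" and g: "g \<in> harmonic_dirichlet \<omega>"
  shows "harmonic_dirichlet_inner \<omega> f g = L2_inner circle_measure f g
     + L2_inner (energy_measure \<omega>) (cauchy_transform_deriv f) (cauchy_transform_deriv g)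
     + L2_inner (energy_measure \<omega>) (conj_cauchy_transform_deriv f) (conj_cauchy_transform_deriv g)"
proof -
  note F = harmonic_dirichletD[OF \<omega> f] and G = harmonic_dirichletD[OF \<omega> g]
  let ?h = "\<lambda>z. cauchy_transform_deriv f z * cnj (cauchy_transform_deriv g z)
      + conj_cauchy_transform_deriv f z * cnj (conj_cauchy_transform_deriv g z)"
  have \<omega>': "\<omega> \<in> borel_measurable disk_area" "AE z in disk_area. 0 \<le> \<omega> z"
    using \<omega> by (auto simp: weight_def space_disk_area intro!: AE_I2)
  have h: "integrable (energy_measure \<omega>) (\<lambda>z. cauchy_transform_deriv f z * cnj (cauchy_transform_deriv g z))"
    "integrable (energy_measure \<omega>) (\<lambda>z. conj_cauchy_transform_deriv f z * cnj (conj_cauchy_transform_deriv g z))"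
    by (intro integrable_mult_cnj F G)+
  have "?h \<in> borel_measurable (energy_measure \<omega>)"
    using h by (intro borel_measurable_integrable Bochner_Integration.integrable_add)
  then have hm: "?h \<in> borel_measurable disk_area"
    by (simp add: energy_measure_def)
  have "dirichlet_form \<omega> f g = (LINT z|disk_area. \<omega> z *\<^sub>R ?h z)"
    unfolding dirichlet_form_def
  proof (rule Bochner_Integration.integral_cong)
    fix z assume "z \<in> space disk_area"
    then have z: "z \<in> ball 0 1"
      by (simp add: space_disk_area)
    show "(wirtinger (poisson_extension f) z * cnj (wirtinger (poisson_extension g) z)
         + wirtinger_bar (poisson_extension f) z * cnj (wirtinger_bar (poisson_extension g) z))
        * complex_of_real (\<omega> z) = \<omega> z *\<^sub>R ?h z"
      unfolding wirtinger_poisson_extension[OF F(2) z] wirtinger_poisson_extension[OF G(2) z]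
      by (simp only: scaleR_conv_of_real mult.commute)
  qed simp
  also have "\<dots> = (LINT z|energy_measure \<omega>. ?h z)"
    unfolding energy_measure_def by (rule integral_density[symmetric, OF hm \<omega>'])
  also have "\<dots> = L2_inner (energy_measure \<omega>) (cauchy_transform_deriv f) (cauchy_transform_deriv g)
     + L2_inner (energy_measure \<omega>) (conj_cauchy_transform_deriv f) (conj_cauchy_transform_deriv g)"
    unfolding L2_inner_def by (rule Bochner_Integration.integral_add[OF h])
  finally show ?thesis
    by (simp add: harmonic_dirichlet_inner_def circle_inner_eq)
qed

lemma harmonic_dirichlet_inner_self:
  assumes "weight \<omega>" "f \<in> harmonic_dirichlet \<omega>"
  shows "harmonic_dirichlet_inner \<omega> f f = of_real
     ((LINT \<zeta>|circle_measure. (cmod (f \<zeta>))\<^sup>2)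
      + (LINT z|energy_measure \<omega>. (cmod (cauchy_transform_deriv f z))\<^sup>2)
      + (LINT z|energy_measure \<omega>. (cmod (conj_cauchy_transform_deriv f z))\<^sup>2))"
  by (simp add: harmonic_dirichlet_inner_eq[OF assms assms(2)] L2_inner_self)

lemma inner_norm_harmonic_dirichlet:
  assumes "weight \<omega>" "f \<in> harmonic_dirichlet \<omega>"
  shows "(inner_norm (harmonic_dirichlet_inner \<omega>) f)\<^sup>2 =
     (LINT \<zeta>|circle_measure. (cmod (f \<zeta>))\<^sup>2)
      + (LINT z|energy_measure \<omega>. (cmod (cauchy_transform_deriv f z))\<^sup>2)
      + (LINT z|energy_measure \<omega>. (cmod (conj_cauchy_transform_deriv f z))\<^sup>2)"
  by (simp add: inner_norm_def harmonic_dirichlet_inner_self[OF assms])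

lemma inner_norm_ge_parts:
  assumes "weight \<omega>" "f \<in> harmonic_dirichlet \<omega>"
  shows "(LINT \<zeta>|circle_measure. (cmod (f \<zeta>))\<^sup>2) \<le> (inner_norm (harmonic_dirichlet_inner \<omega>) f)\<^sup>2"
    and "(LINT z|energy_measure \<omega>. (cmod (cauchy_transform_deriv f z))\<^sup>2)
           \<le> (inner_norm (harmonic_dirichlet_inner \<omega>) f)\<^sup>2"
    and "(LINT z|energy_measure \<omega>. (cmod (conj_cauchy_transform_deriv f z))\<^sup>2)
           \<le> (inner_norm (harmonic_dirichlet_inner \<omega>) f)\<^sup>2"
  by (simp_all add: inner_norm_harmonic_dirichlet[OF assms] add_nonneg_nonneg)

lemma inner_norm_nonneg:
  assumes "weight \<omega>" "f \<in> harmonic_dirichlet \<omega>"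
  shows "0 \<le> inner_norm (harmonic_dirichlet_inner \<omega>) f"
  by (simp add: inner_norm_def harmonic_dirichlet_inner_self[OF assms])

text \<open>
  The norm in terms of the extended-valued energy, in which the Douglas formula is stated.
\<close>

lemma ennreal_inner_norm_harmonic_dirichlet:
  assumes \<omega>: "weight \<omega>" and f: "f \<in> harmonic_dirichlet \<omega>"
  shows "ennreal ((inner_norm (harmonic_dirichlet_inner \<omega>) f)\<^sup>2) =
     (\<integral>\<^sup>+\<zeta>. ennreal ((cmod (f \<zeta>))\<^sup>2) \<partial>circle_measure) + dirichlet_energy \<omega> f"
proof -
  note F = harmonic_dirichletD[OF assms]
  show ?thesis
    unfolding inner_norm_harmonic_dirichlet[OF assms] dirichlet_energy_eq[OF \<omega> F(2)]
    using F(1,3,4)[THEN square_integrableD(2)]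
    by (simp add: nn_integral_eq_integral add.assoc)
qed

text \<open>The derivatives are additive in \<open>f\<close> only on the disk, so functions are compared there.\<close>

lemma square_integrable_energy_cong:
  assumes "f \<in> square_integrable (energy_measure \<omega>)" "\<And>z. cmod z < 1 \<Longrightarrow> g z = f z"
  shows "g \<in> square_integrable (energy_measure \<omega>)"
proof -
  have "g \<in> borel_measurable (energy_measure \<omega>) \<longleftrightarrow> f \<in> borel_measurable (energy_measure \<omega>)"
    by (rule measurable_cong) (simp add: assms(2) space_energy_measure)
  then have "g \<in> borel_measurable (energy_measure \<omega>)"
    using square_integrableD(1)[OF assms(1)] by simp
  with assms(1) show ?thesis
    by (rule square_integrable_dominated) (simp add: assms(2) space_energy_measure)
qed

lemma harmonic_dirichlet_add:
  assumes \<omega>: "weight \<omega>" and f: "f \<in> harmonic_dirichlet \<omega>" and g: "g \<in> harmonic_dirichlet \<omega>"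
  shows "(\<lambda>\<zeta>. f \<zeta> + g \<zeta>) \<in> harmonic_dirichlet \<omega>"
proof -
  note F = harmonic_dirichletD[OF \<omega> f] and G = harmonic_dirichletD[OF \<omega> g]
  have "cauchy_transform_deriv (\<lambda>\<zeta>. f \<zeta> + g \<zeta>) \<in> square_integrable (energy_measure \<omega>)"
    by (rule square_integrable_energy_cong[OF square_integrable_add[OF F(3) G(3)]])
       (rule cauchy_transform_deriv_add[OF F(2) G(2)])
  moreover have "conj_cauchy_transform_deriv (\<lambda>\<zeta>. f \<zeta> + g \<zeta>) \<in> square_integrable (energy_measure \<omega>)"
    by (rule square_integrable_energy_cong[OF square_integrable_add[OF F(4) G(4)]])
       (rule conj_cauchy_transform_deriv_add[OF F(2) G(2)])
  ultimately show ?thesis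
    using square_integrable_add[OF F(1) G(1)] by (simp add: harmonic_dirichlet_iff[OF \<omega>])
qed

lemma harmonic_dirichlet_scale:
  assumes \<omega>: "weight \<omega>" and f: "f \<in> harmonic_dirichlet \<omega>"
  shows "(\<lambda>\<zeta>. c * f \<zeta>) \<in> harmonic_dirichlet \<omega>"
proof -
  note F = harmonic_dirichletD[OF \<omega> f]
  have "cauchy_transform_deriv (\<lambda>\<zeta>. c * f \<zeta>) = (\<lambda>z. c * cauchy_transform_deriv f z)"
    "conj_cauchy_transform_deriv (\<lambda>\<zeta>. c * f \<zeta>) = (\<lambda>z. c * conj_cauchy_transform_deriv f z)"
    by (simp_all add: fun_eq_iff cauchy_transform_deriv_scale conj_cauchy_transform_deriv_scale)
  then show ?thesis
    using F by (simp add: harmonic_dirichlet_iff[OF \<omega>] square_integrable_scale)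
qed

lemma harmonic_dirichlet_diff:
  assumes "weight \<omega>" "f \<in> harmonic_dirichlet \<omega>" "g \<in> harmonic_dirichlet \<omega>"
  shows "(\<lambda>\<zeta>. f \<zeta> - g \<zeta>) \<in> harmonic_dirichlet \<omega>"
  using harmonic_dirichlet_add[OF assms(1,2) harmonic_dirichlet_scale[OF assms(1,3), of "-1"]] by simp

lemma harmonic_dirichlet_inner_add:
  assumes \<omega>: "weight \<omega>"
    and f: "f \<in> harmonic_dirichlet \<omega>" and g: "g \<in> harmonic_dirichlet \<omega>" and h: "h \<in> harmonic_dirichlet \<omega>"
  shows "harmonic_dirichlet_inner \<omega> (\<lambda>\<zeta>. f \<zeta> + g \<zeta>) h
    = harmonic_dirichlet_inner \<omega> f h + harmonic_dirichlet_inner \<omega> g h"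
proof -
  note F = harmonic_dirichletD[OF \<omega> f] and G = harmonic_dirichletD[OF \<omega> g]
    and H = harmonic_dirichletD[OF \<omega> h]
  have "L2_inner (energy_measure \<omega>) (cauchy_transform_deriv (\<lambda>\<zeta>. f \<zeta> + g \<zeta>)) (cauchy_transform_deriv h)
      = L2_inner (energy_measure \<omega>) (\<lambda>z. cauchy_transform_deriv f z + cauchy_transform_deriv g z)
          (cauchy_transform_deriv h)"
    "L2_inner (energy_measure \<omega>) (conj_cauchy_transform_deriv (\<lambda>\<zeta>. f \<zeta> + g \<zeta>))
        (conj_cauchy_transform_deriv h)
      = L2_inner (energy_measure \<omega>) (\<lambda>z. conj_cauchy_transform_deriv f z
          + conj_cauchy_transform_deriv g z) (conj_cauchy_transform_deriv h)"
    unfolding L2_inner_def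
    by (auto intro!: Bochner_Integration.integral_cong simp: space_energy_measure
        cauchy_transform_deriv_add[OF F(2) G(2)] conj_cauchy_transform_deriv_add[OF F(2) G(2)])
  then show ?thesis
    using F G H
    by (simp add: harmonic_dirichlet_inner_eq[OF \<omega>] harmonic_dirichlet_add[OF \<omega>] f g h L2_inner_add_left)
qed

lemma harmonic_dirichlet_inner_scale:
  assumes \<omega>: "weight \<omega>" and f: "f \<in> harmonic_dirichlet \<omega>" and g: "g \<in> harmonic_dirichlet \<omega>"
  shows "harmonic_dirichlet_inner \<omega> (\<lambda>\<zeta>. c * f \<zeta>) g = c * harmonic_dirichlet_inner \<omega> f g"
proof -
  have "cauchy_transform_deriv (\<lambda>\<zeta>. c * f \<zeta>) = (\<lambda>z. c * cauchy_transform_deriv f z)"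
    "conj_cauchy_transform_deriv (\<lambda>\<zeta>. c * f \<zeta>) = (\<lambda>z. c * conj_cauchy_transform_deriv f z)"
    by (simp_all add: fun_eq_iff cauchy_transform_deriv_scale conj_cauchy_transform_deriv_scale)
  then show ?thesis
    by (simp add: harmonic_dirichlet_inner_eq[OF \<omega>] harmonic_dirichlet_scale[OF \<omega>] f g
        L2_inner_scale_left distrib_left)
qed

lemma harmonic_dirichlet_inner_commute:
  assumes \<omega>: "weight \<omega>" and f: "f \<in> harmonic_dirichlet \<omega>" and g: "g \<in> harmonic_dirichlet \<omega>"
  shows "harmonic_dirichlet_inner \<omega> g f = cnj (harmonic_dirichlet_inner \<omega> f g)"
  unfolding harmonic_dirichlet_inner_eq[OF \<omega> f g] harmonic_dirichlet_inner_eq[OF \<omega> g f]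
  by (subst (1 2 3) L2_inner_commute) simp

lemma harmonic_dirichlet_cong_AE:
  assumes f: "f \<in> harmonic_dirichlet \<omega>" and g: "g \<in> borel_measurable circle_measure"
    and eq: "AE \<zeta> in circle_measure. g \<zeta> = f \<zeta>"
  shows "g \<in> harmonic_dirichlet \<omega>"
    and "h \<in> harmonic_dirichlet \<omega> \<Longrightarrow> harmonic_dirichlet_inner \<omega> g h = harmonic_dirichlet_inner \<omega> f h"
proof -
  have f2: "f \<in> circle_L2"
    using f by (simp add: harmonic_dirichlet_def)
  then have fm: "f \<in> borel_measurable circle_measure"
    by (simp add: circle_L2_def)
  have P: "poisson_extension g = poisson_extension f"
    by (rule poisson_extension_cong_AE[OF fm g eq])
  show "g \<in> harmonic_dirichlet \<omega>"
    using f circle_L2_cong_AE[OF f2 g eq]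
    by (simp add: harmonic_dirichlet_def dirichlet_energy_def P)
  assume "h \<in> harmonic_dirichlet \<omega>"
  then have "h \<in> borel_measurable circle_measure"
    by (simp add: harmonic_dirichlet_def circle_L2_def)
  note [measurable] = this g fm
  have "circle_inner g h = circle_inner f h"
    unfolding circle_inner_def by (rule integral_cong_AE) (use eq in auto)
  then show "harmonic_dirichlet_inner \<omega> g h = harmonic_dirichlet_inner \<omega> f h"
    by (simp add: harmonic_dirichlet_inner_def dirichlet_form_def P)
qed

lemma L1_le_inner_norm:
  assumes "weight \<omega>" "f \<in> harmonic_dirichlet \<omega>"
  shows "(LINT \<zeta>|circle_measure. cmod (f \<zeta>)) \<le> inner_norm (harmonic_dirichlet_inner \<omega>) f"
proof (rule power2_le_imp_le)
  have "(LINT \<zeta>|circle_measure. cmod (f \<zeta>))\<^sup>2 \<le> (LINT \<zeta>|circle_measure. (cmod (f \<zeta>))\<^sup>2)"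
    by (rule circle.L1_norm_le_L2_norm(2)[OF harmonic_dirichletD(1)[OF assms]])
  also have "\<dots> \<le> (inner_norm (harmonic_dirichlet_inner \<omega>) f)\<^sup>2"
    by (rule inner_norm_ge_parts(1)[OF assms])
  finally show "(LINT \<zeta>|circle_measure. cmod (f \<zeta>))\<^sup>2
      \<le> (inner_norm (harmonic_dirichlet_inner \<omega>) f)\<^sup>2" .
qed (rule inner_norm_nonneg[OF assms])

text \<open>
  Lower semicontinuity of the norm of the Dirichlet space: convergence in \<open>L\<^sup>1\<close> gives pointwise
  convergence of both Wirtinger derivatives on the disk, so Fatou's lemma applies to each of the
  three square integrals. The factor \<open>3\<close> comes from bounding them separately.
\<close>

lemma harmonic_dirichlet_limit:
  assumes \<omega>: "weight \<omega>" and g: "\<And>k. g k \<in> harmonic_dirichlet \<omega>"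
    and h: "h \<in> square_integrable circle_measure"
    and AE: "AE \<zeta> in circle_measure. (\<lambda>k. g k \<zeta>) \<longlonglongrightarrow> h \<zeta>"
    and L1: "(\<lambda>k. LINT \<zeta>|circle_measure. cmod (g k \<zeta> - h \<zeta>)) \<longlonglongrightarrow> 0"
    and le: "\<And>k. inner_norm (harmonic_dirichlet_inner \<omega>) (g k) \<le> c"
  shows "h \<in> harmonic_dirichlet \<omega>" "(inner_norm (harmonic_dirichlet_inner \<omega>) h)\<^sup>2 \<le> 3 * c\<^sup>2"
proof -
  note G = harmonic_dirichletD[OF \<omega> g]
  have h1: "integrable circle_measure h"
    by (rule circle.L1_norm_le_L2_norm(1)[OF h])
  have "(inner_norm (harmonic_dirichlet_inner \<omega>) (g k))\<^sup>2 \<le> c\<^sup>2" for k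
    using le[of k] inner_norm_nonneg[OF \<omega> g] by (intro power_mono)
  then have le': "(LINT \<zeta>|circle_measure. (cmod (g k \<zeta>))\<^sup>2) \<le> c\<^sup>2"
    "(LINT z|energy_measure \<omega>. (cmod (cauchy_transform_deriv (g k) z))\<^sup>2) \<le> c\<^sup>2"
    "(LINT z|energy_measure \<omega>. (cmod (conj_cauchy_transform_deriv (g k) z))\<^sup>2) \<le> c\<^sup>2" for k
    using inner_norm_ge_parts[OF \<omega> g[of k]] by (meson order_trans)+
  have AE1: "AE z in energy_measure \<omega>.
      (\<lambda>k. cauchy_transform_deriv (g k) z) \<longlonglongrightarrow> cauchy_transform_deriv h z"
    "AE z in energy_measure \<omega>.
      (\<lambda>k. conj_cauchy_transform_deriv (g k) z) \<longlonglongrightarrow> conj_cauchy_transform_deriv h z"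
    by (auto intro!: AE_I2 cauchy_transform_deriv_tendsto[OF h1 G(2) _ L1] simp: space_energy_measure)
  note hm = borel_measurable_energy_measure[OF square_integrableD(1)[OF h], of \<omega>]
  note lim1 = square_integrable_limit[OF G(3) hm(1) AE1(1) le'(2)]
    and lim2 = square_integrable_limit[OF G(4) hm(2) AE1(2) le'(3)]
  show *: "h \<in> harmonic_dirichlet \<omega>"
    using h lim1(1) lim2(1) by (simp add: harmonic_dirichlet_iff[OF \<omega>])
  show "(inner_norm (harmonic_dirichlet_inner \<omega>) h)\<^sup>2 \<le> 3 * c\<^sup>2"
    using square_integrable_limit(2)[OF G(1) square_integrableD(1)[OF h] AE le'(1)] lim1(2) lim2(2)
    unfolding inner_norm_harmonic_dirichlet[OF \<omega> *] by linarith
qed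

text \<open>
  Fatou's lemma is applied twice to \<open>F n - F (r (k + N))\<close> as \<open>k\<close> grows: on the circle to find the
  limit \<open>f\<close> in \<open>L\<^sup>2\<close>, then for the full norm through \<open>harmonic_dirichlet_limit\<close>. That \<open>f\<close> lies in the
  space follows from \<open>f = F N - (F N - f)\<close>.
\<close>

lemma harmonic_dirichlet_complete:
  assumes \<omega>: "weight \<omega>" and F: "\<And>n::nat. F n \<in> harmonic_dirichlet \<omega>"
    and cauchy: "\<And>\<epsilon>. \<epsilon> > 0 \<Longrightarrow>
      \<exists>N. \<forall>m\<ge>N. \<forall>n\<ge>N. inner_norm (harmonic_dirichlet_inner \<omega>) (\<lambda>\<zeta>. F m \<zeta> - F n \<zeta>) < \<epsilon>"
  shows "\<exists>f\<in>harmonic_dirichlet \<omega>.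
    (\<lambda>n. inner_norm (harmonic_dirichlet_inner \<omega>) (\<lambda>\<zeta>. F n \<zeta> - f \<zeta>)) \<longlonglongrightarrow> 0"
proof -
  let ?N = "inner_norm (harmonic_dirichlet_inner \<omega>)"
  note FD = harmonic_dirichletD[OF \<omega> F]
  note [measurable] = square_integrableD(1)[OF FD(1)]
  have diff: "(\<lambda>\<zeta>. F m \<zeta> - F n \<zeta>) \<in> harmonic_dirichlet \<omega>" for m n
    by (rule harmonic_dirichlet_diff[OF \<omega> F F])
  have "\<exists>N. \<forall>i\<ge>N. \<forall>j\<ge>N. (LINT \<zeta>|circle_measure. cmod (F i \<zeta> - F j \<zeta>)) < e" if "e > 0" for e
    using cauchy[OF that] L1_le_inner_norm[OF \<omega> diff] by (meson le_less_trans)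
  then obtain r where r: "strict_mono r" and rC: "AE \<zeta> in circle_measure. Cauchy (\<lambda>i. F (r i) \<zeta>)"
    using cauchy_L1_AE_cauchy_subseq[of circle_measure F] FD(2) by metis
  define f where "f \<zeta> = lim (\<lambda>i. F (r i) \<zeta>)" for \<zeta>
  have [measurable]: "f \<in> borel_measurable circle_measure"
    unfolding f_def by measurable
  have lim: "AE \<zeta> in circle_measure. (\<lambda>i. F (r i) \<zeta>) \<longlonglongrightarrow> f \<zeta>"
    using rC by eventually_elim (simp add: f_def Cauchy_convergent_iff convergent_LIMSEQ_iff)
  \<comment> \<open>The shift by \<open>N\<close> makes every member of the sequence satisfy the Cauchy bound, as \<open>N \<le> r (k + N)\<close>.\<close>
  have limD: "AE \<zeta> in circle_measure. (\<lambda>k. F n \<zeta> - F (r (k + N)) \<zeta>) \<longlonglongrightarrow> F n \<zeta> - f \<zeta>" for n N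
    using lim
  proof eventually_elim
    case (elim \<zeta>)
    then show ?case
      by (intro tendsto_diff tendsto_const) (rule LIMSEQ_ignore_initial_segment)
  qed
  \<comment> \<open>The limit is first identified in \<open>L\<^sup>2\<close> of the circle; this gives the \<open>L\<^sup>1\<close> convergence on
    which the convergence of the derivatives rests.\<close>
  have L2: "(\<lambda>\<zeta>. F n \<zeta> - f \<zeta>) \<in> square_integrable circle_measure"
    "(LINT \<zeta>|circle_measure. (cmod (F n \<zeta> - f \<zeta>))\<^sup>2) \<le> e\<^sup>2"
    if N: "\<forall>m\<ge>N. \<forall>n\<ge>N. ?N (\<lambda>\<zeta>. F m \<zeta> - F n \<zeta>) < e" "n \<ge> N" for n N e
  proof -
    have "(LINT \<zeta>|circle_measure. (cmod (F n \<zeta> - F (r (k + N)) \<zeta>))\<^sup>2) \<le> e\<^sup>2" for k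
    proof -
      have "N \<le> r (k + N)"
        using seq_suble[OF r, of "k + N"] by simp
      then have "?N (\<lambda>\<zeta>. F n \<zeta> - F (r (k + N)) \<zeta>) \<le> e"
        using N by (simp add: less_imp_le)
      then have "(?N (\<lambda>\<zeta>. F n \<zeta> - F (r (k + N)) \<zeta>))\<^sup>2 \<le> e\<^sup>2"
        by (intro power_mono inner_norm_nonneg[OF \<omega> diff])
      with inner_norm_ge_parts(1)[OF \<omega> diff] show ?thesis
        by (rule order_trans)
    qed
    note * = square_integrable_limit[OF harmonic_dirichletD(1)[OF \<omega> diff] _ limD this]
    show "(\<lambda>\<zeta>. F n \<zeta> - f \<zeta>) \<in> square_integrable circle_measure"
      "(LINT \<zeta>|circle_measure. (cmod (F n \<zeta> - f \<zeta>))\<^sup>2) \<le> e\<^sup>2"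
      by (rule *; measurable)+
  qed
  have f2: "f \<in> square_integrable circle_measure"
  proof -
    obtain N where "\<forall>m\<ge>N. \<forall>n\<ge>N. ?N (\<lambda>\<zeta>. F m \<zeta> - F n \<zeta>) < 1"
      using cauchy[of 1] by auto
    from square_integrable_diff[OF FD(1)[of N] L2(1)[OF this order_refl]] show ?thesis
      by simp
  qed
  have dL2: "(\<lambda>\<zeta>. F n \<zeta> - f \<zeta>) \<in> square_integrable circle_measure" for n
    by (rule square_integrable_diff[OF FD(1) f2])
  have L1: "(\<lambda>n. LINT \<zeta>|circle_measure. cmod (F n \<zeta> - f \<zeta>)) \<longlonglongrightarrow> 0"
  proof (rule LIMSEQ_I)
    fix e :: real assume e: "0 < e"
    obtain N where N: "\<forall>m\<ge>N. \<forall>n\<ge>N. ?N (\<lambda>\<zeta>. F m \<zeta> - F n \<zeta>) < e / 2"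
      using cauchy[of "e / 2"] e by auto
    have "(LINT \<zeta>|circle_measure. cmod (F n \<zeta> - f \<zeta>)) \<le> e / 2" if "n \<ge> N" for n
    proof (rule power2_le_imp_le)
      show "(LINT \<zeta>|circle_measure. cmod (F n \<zeta> - f \<zeta>))\<^sup>2 \<le> (e / 2)\<^sup>2"
        using circle.L1_norm_le_L2_norm(2)[OF dL2] L2(2)[OF N that] by (rule order_trans)
    qed (use e in simp)
    moreover have "0 \<le> (LINT \<zeta>|circle_measure. cmod (F n \<zeta> - f \<zeta>))" for n
      by (auto intro!: integral_nonneg_AE)
    ultimately have "\<forall>n\<ge>N. norm ((LINT \<zeta>|circle_measure. cmod (F n \<zeta> - f \<zeta>)) - 0) < e"
      using e by fastforce
    then show "\<exists>N. \<forall>n\<ge>N. norm ((LINT \<zeta>|circle_measure. cmod (F n \<zeta> - f \<zeta>)) - 0) < e"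
      by blast
  qed
  have main: "(\<lambda>\<zeta>. F n \<zeta> - f \<zeta>) \<in> harmonic_dirichlet \<omega>" "(?N (\<lambda>\<zeta>. F n \<zeta> - f \<zeta>))\<^sup>2 \<le> 3 * e\<^sup>2"
    if N: "\<forall>m\<ge>N. \<forall>n\<ge>N. ?N (\<lambda>\<zeta>. F m \<zeta> - F n \<zeta>) < e" "n \<ge> N" for n N e
  proof -
    have "?N (\<lambda>\<zeta>. F n \<zeta> - F (r (k + N)) \<zeta>) \<le> e" for k
    proof -
      have "N \<le> r (k + N)"
        using seq_suble[OF r, of "k + N"] by simp
      then show ?thesis
        using N by (simp add: less_imp_le)
    qed
    moreover have "(\<lambda>k. LINT \<zeta>|circle_measure. cmod ((F n \<zeta> - F (r (k + N)) \<zeta>) - (F n \<zeta> - f \<zeta>))) \<longlonglongrightarrow> 0"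
      using LIMSEQ_ignore_initial_segment[OF LIMSEQ_subseq_LIMSEQ[OF L1 r], of N]
      by (simp add: o_def norm_minus_commute)
    ultimately show "(\<lambda>\<zeta>. F n \<zeta> - f \<zeta>) \<in> harmonic_dirichlet \<omega>"
      "(?N (\<lambda>\<zeta>. F n \<zeta> - f \<zeta>))\<^sup>2 \<le> 3 * e\<^sup>2"
      using harmonic_dirichlet_limit[OF \<omega> diff dL2 limD] by blast+
  qed
  have fD: "f \<in> harmonic_dirichlet \<omega>"
  proof -
    obtain N where "\<forall>m\<ge>N. \<forall>n\<ge>N. ?N (\<lambda>\<zeta>. F m \<zeta> - F n \<zeta>) < 1"
      using cauchy[of 1] by auto
    from harmonic_dirichlet_diff[OF \<omega> F[of N] main(1)[OF this order_refl]] show ?thesis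
      by simp
  qed
  have "(\<lambda>n. ?N (\<lambda>\<zeta>. F n \<zeta> - f \<zeta>)) \<longlonglongrightarrow> 0"
  proof (rule LIMSEQ_I)
    fix e :: real assume e: "0 < e"
    obtain N where N: "\<forall>m\<ge>N. \<forall>n\<ge>N. ?N (\<lambda>\<zeta>. F m \<zeta> - F n \<zeta>) < e / 2"
      using cauchy[of "e / 2"] e by auto
    have "?N (\<lambda>\<zeta>. F n \<zeta> - f \<zeta>) < e" if "n \<ge> N" for n
    proof (rule power2_less_imp_less)
      have "3 * (e / 2)\<^sup>2 < e\<^sup>2"
        using e by (simp add: power_divide)
      then show "(?N (\<lambda>\<zeta>. F n \<zeta> - f \<zeta>))\<^sup>2 < e\<^sup>2"
        using main(2)[OF N that] by (rule le_less_trans[rotated])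
    qed (use e in simp)
    then have "\<forall>n\<ge>N. norm (?N (\<lambda>\<zeta>. F n \<zeta> - f \<zeta>) - 0) < e"
      using inner_norm_nonneg[OF \<omega> main(1)[OF N]] by auto
    then show "\<exists>N. \<forall>n\<ge>N. norm (?N (\<lambda>\<zeta>. F n \<zeta> - f \<zeta>) - 0) < e"
      by blast
  qed
  with fD show ?thesis
    by blast
qed

text \<open>
  Definiteness comes from the \<open>L\<^sup>2\<close> part of the norm; the energy alone vanishes on constants.
\<close>

theorem hilbert_function_space_harmonic_dirichlet:
  assumes \<omega>: "weight \<omega>"
  shows "hilbert_function_space (harmonic_dirichlet \<omega>) (harmonic_dirichlet_inner \<omega>)"
proof -
  have zero: "(\<lambda>\<zeta>. 0) \<in> harmonic_dirichlet \<omega>"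
  proof -
    have "cauchy_transform_deriv (\<lambda>\<zeta>. 0) = (\<lambda>z. 0)" "conj_cauchy_transform_deriv (\<lambda>\<zeta>. 0) = (\<lambda>z. 0)"
      by (simp_all add: fun_eq_iff cauchy_transform_deriv_def conj_cauchy_transform_deriv_def)
    then show ?thesis
      by (simp add: harmonic_dirichlet_iff[OF \<omega>] square_integrable_zero)
  qed
  have definite: "AE \<zeta> in circle_measure. f \<zeta> = 0"
    if f: "f \<in> harmonic_dirichlet \<omega>" and 0: "harmonic_dirichlet_inner \<omega> f f = 0" for f
  proof -
    note F = harmonic_dirichletD[OF \<omega> f]
    have "0 \<le> (LINT \<zeta>|circle_measure. (cmod (f \<zeta>))\<^sup>2)"
      "0 \<le> (LINT z|energy_measure \<omega>. (cmod (cauchy_transform_deriv f z))\<^sup>2)"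
      "0 \<le> (LINT z|energy_measure \<omega>. (cmod (conj_cauchy_transform_deriv f z))\<^sup>2)"
      by (auto intro!: integral_nonneg_AE)
    with 0 have "(LINT \<zeta>|circle_measure. (cmod (f \<zeta>))\<^sup>2) = 0"
      unfolding harmonic_dirichlet_inner_self[OF \<omega> f] of_real_eq_0_iff by linarith
    then show ?thesis
      using integral_nonneg_eq_0_iff_AE[OF square_integrableD(2)[OF F(1)]] by simp
  qed
  have "harmonic_dirichlet \<omega> \<subseteq> borel_measurable circle_measure"
    by (auto simp: harmonic_dirichlet_def circle_L2_def)
  then show ?thesis
    unfolding hilbert_function_space_def
    by (intro conjI ballI allI impI)
       (auto intro: zero definite harmonic_dirichlet_cong_AE harmonic_dirichlet_add[OF \<omega>]
         harmonic_dirichlet_scale[OF \<omega>] harmonic_dirichlet_inner_add[OF \<omega>]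
         harmonic_dirichlet_inner_scale[OF \<omega>] harmonic_dirichlet_inner_commute[OF \<omega>]
         harmonic_dirichlet_complete[OF \<omega>] simp: harmonic_dirichlet_inner_self[OF \<omega>])
qed


section \<open>Normalized contractions\<close>

lemma normalized_contraction_cmod_le:
  assumes "normalized_contraction T"
  shows "cmod (T a) \<le> cmod a"
proof -
  have "cmod (T a - T 0) \<le> cmod (a - 0)"
    using assms unfolding normalized_contraction_def by blast
  with assms show ?thesis
    by (simp add: normalized_contraction_def)
qed

lemma normalized_contraction_measurable:
  assumes "normalized_contraction T"
  shows "T \<in> borel_measurable borel"
proof -
  have "1-lipschitz_on UNIV T"
    using assms by (auto simp: normalized_contraction_def lipschitz_on_def dist_norm)
  then show ?thesis
    by (intro borel_measurable_continuous_onI lipschitz_on_continuous_on)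
qed

text \<open>
  \<open>T\<close> maps each representative of \<open>f\<close> to a representative of \<open>T \<circ> f\<close> with an integrand that is
  nowhere larger, so the infimum for \<open>T \<circ> f\<close> is at most the one for \<open>f\<close>, whatever the measure \<open>J\<close>.
\<close>

lemma douglas_form_contraction:
  assumes T: "normalized_contraction T"
  shows "douglas_form J (T \<circ> f) \<le> douglas_form J f"
  unfolding douglas_form_def
proof (rule INF_mono)
  fix g assume g: "g \<in> {g \<in> borel_measurable circle_measure. AE \<zeta> in circle_measure. g \<zeta> = f \<zeta>}"
  have "T \<circ> g \<in> borel_measurable circle_measure"
    using g normalized_contraction_measurable[OF T] by (auto intro: measurable_comp)
  moreover have "AE \<zeta> in circle_measure. (T \<circ> g) \<zeta> = (T \<circ> f) \<zeta>"
    using g by auto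
  moreover have "douglas_integral J (T \<circ> g) \<le> douglas_integral J g"
    unfolding douglas_integral_def
    using T by (intro nn_integral_mono)
      (auto simp: normalized_contraction_def intro!: ennreal_leI power_mono)
  ultimately show "\<exists>h\<in>{g \<in> borel_measurable circle_measure. AE \<zeta> in circle_measure. g \<zeta> = (T \<circ> f) \<zeta>}.
      douglas_integral J h \<le> douglas_integral J g"
    by blast
qed

lemma harmonic_dirichlet_contraction:
  assumes dou: "douglas_weight \<omega>" and T: "normalized_contraction T" and f: "f \<in> harmonic_dirichlet \<omega>"
  shows "T \<circ> f \<in> harmonic_dirichlet \<omega>"
    and "inner_norm (harmonic_dirichlet_inner \<omega>) (T \<circ> f) \<le> inner_norm (harmonic_dirichlet_inner \<omega>) f"
proof -
  have \<omega>: "weight \<omega>"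
    using dou by (simp add: douglas_weight_def)
  obtain J where J: "\<And>f. f \<in> circle_L2 \<Longrightarrow> dirichlet_energy \<omega> f = douglas_form J f"
    using dou by (auto simp: douglas_weight_def)
  have f2: "f \<in> circle_L2" and fin: "dirichlet_energy \<omega> f < \<infinity>"
    using f by (simp_all add: harmonic_dirichlet_def)
  have "T \<circ> f \<in> borel_measurable circle_measure"
    using f2 normalized_contraction_measurable[OF T] by (auto simp: circle_L2_def intro: measurable_comp)
  with f2[unfolded circle_L2_eq] have Tf2: "T \<circ> f \<in> circle_L2"
    unfolding circle_L2_eq
    by (rule square_integrable_dominated) (simp add: normalized_contraction_cmod_le[OF T])
  have le: "dirichlet_energy \<omega> (T \<circ> f) \<le> dirichlet_energy \<omega> f"
    by (simp add: J f2 Tf2 douglas_form_contraction[OF T])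
  then show Tf: "T \<circ> f \<in> harmonic_dirichlet \<omega>"
    using Tf2 le_less_trans[OF le fin] by (simp add: harmonic_dirichlet_def)
  have "ennreal ((inner_norm (harmonic_dirichlet_inner \<omega>) (T \<circ> f))\<^sup>2)
      \<le> ennreal ((inner_norm (harmonic_dirichlet_inner \<omega>) f)\<^sup>2)"
    unfolding ennreal_inner_norm_harmonic_dirichlet[OF \<omega> f] ennreal_inner_norm_harmonic_dirichlet[OF \<omega> Tf]
    by (intro add_mono le nn_integral_mono ennreal_leI power_mono)
       (auto simp: normalized_contraction_cmod_le[OF T])
  then show "inner_norm (harmonic_dirichlet_inner \<omega>) (T \<circ> f) \<le> inner_norm (harmonic_dirichlet_inner \<omega>) f"
    using inner_norm_nonneg[OF \<omega> f] by (auto intro: power2_le_imp_le)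
qed

theorem proposition2p1:
  fixes \<omega> :: "complex \<Rightarrow> real"
  assumes "douglas_weight \<omega>"
  shows "beurling_deny_space (harmonic_dirichlet \<omega>) (harmonic_dirichlet_inner \<omega>)"
proof -
  have \<omega>: "weight \<omega>"
    using assms by (simp add: douglas_weight_def)
  have local_bound: "set_integrable circle_measure K f"
    "(LINT \<zeta>:K|circle_measure. cmod (f \<zeta>)) \<le> 1 * inner_norm (harmonic_dirichlet_inner \<omega>) f"
    if K: "compact K" "K \<subseteq> sphere 0 1" and f: "f \<in> harmonic_dirichlet \<omega>" for K f
  proof -
    have Km: "K \<in> sets circle_measure"
      using K borel_compact[OF K(1)] by (auto simp: circle_measure_def sets_restrict_space)
    have f1: "integrable circle_measure f"
      by (rule harmonic_dirichletD(2)[OF \<omega> f])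
    show "set_integrable circle_measure K f"
      unfolding set_integrable_def using Km f1 by (rule integrable_mult_indicator)
    have "(LINT \<zeta>:K|circle_measure. cmod (f \<zeta>)) \<le> (LINT \<zeta>|circle_measure. cmod (f \<zeta>))"
      unfolding set_lebesgue_integral_def
      using integrable_mult_indicator[OF Km integrable_norm[OF f1]] f1
      by (intro integral_mono) (auto simp: indicator_def)
    also have "\<dots> \<le> inner_norm (harmonic_dirichlet_inner \<omega>) f"
      by (rule L1_le_inner_norm[OF \<omega> f])
    finally show "(LINT \<zeta>:K|circle_measure. cmod (f \<zeta>))
        \<le> 1 * inner_norm (harmonic_dirichlet_inner \<omega>) f"
      by simp
  qed
  show ?thesis
    unfolding beurling_deny_space_def
    by (intro conjI allI impI ballI exI[where x = 1] hilbert_function_space_harmonic_dirichlet[OF \<omega>]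
        local_bound harmonic_dirichlet_contraction[OF assms]) auto
qed

end
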